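(* Let $a,b,c\in\mathbb{R}$ be distinct real numbers and consider the following space curves in the three principal coordinate planes: $$\frac{x^2}{a-c}+\frac{y^2}{b-c}=1 \ \text{ and }\ z=0;\qquad \frac{x^2}{a-b}+\frac{z^2}{c-b}=1 \ \text{ and }\ y=0;\qquad \frac{y^2}{b-a}+\frac{z^2}{c-a}=1 \ \text{ and }\ x=0.$$ In general, two of these curves are real and the third is imaginary. If $\mathbf{u}$ is any point on one of the real curves, then the cone from $\mathbf{u}$ to the other real curve is circular. Furthermore, the axis of symmetry of this cone is the tangent line to the first curve at $\mathbf{u}$. The cone from any other point in space (i.e. any point of $\mathbb{R}^3$ lying on neither of the two real curves) to any one of the real curves is not circular.
   Context: A curve as in the claim is called real if it has real points and imaginary if it has none. For a point $\mathbf{u}\in\mathbb{R}^3$ and a real curve $\gamma\subset\mathbb{R}^3$ (one of the ellipses or hyperbolas in the claim), the cone from $\mathbf{u}$ to $\gamma$ is the union of all lines joining $\mathbf{u}$ to points $\mathbf{p}\in\gamma$, $\mathbf{p}\neq\mathbf{u}$, together with its limit lines (i.e. the topological closure of this union; for a hyperbola this adds the lines through $\mathbf{u}$ parallel to the asymptotes). A circular cone with apex $\mathbf{u}\in\mathbb{R}^3$, axis direction a unit vector $\mathbf{r}\in\mathbb{R}^3$ and angle of aperture $\theta\in[0,\pi/2]$ is the set of all $\mathbf{x}\in\mathbb{R}^3$ satisfying $$(\mathbf{x}-\mathbf{u})^T\left(\mathbf{r}\mathbf{r}^T-(\cos^2\theta)I\right)(\mathbf{x}-\mathbf{u})=0,$$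 where $I$ is the $3\times 3$ identity matrix. Its axis of symmetry is the line $\mathbf{u}+\mathbb{R}\mathbf{r}$. The extreme values $\theta=0$ and $\theta=\pi/2$ correspond to a line and a plane, respectively. A cone from $\mathbf{u}$ to a curve is called circular if it is a circular cone with apex $\mathbf{u}$ for some such $\mathbf{r},\theta$.
   Formalization: The last sentence excludes the case where the cone is the whole plane of the curve (e.g. from the centre of the ellipse), since by the stated convention a plane is a circular cone with aperture π/2, so the claim fails exactly there. *)

theory Defs
  imports "HOL-Analysis.Analysis"
begin

(* The three conics are indexed by the coordinate that vanishes on them.
   In type 3 the numeral 3 equals 0; the indices 1, 2, 3 are distinct and exhaust the type. *)
definition space_curve :: "real \<Rightarrow> real \<Rightarrow> real \<Rightarrow> 3 \<Rightarrow> (real^3) set" where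
  "space_curve a b c k =
    (if k = 3 then {p. (p$1)\<^sup>2 / (a - c) + (p$2)\<^sup>2 / (b - c) = 1 \<and> p$3 = 0}
     else if k = 2 then {p. (p$1)\<^sup>2 / (a - b) + (p$3)\<^sup>2 / (c - b) = 1 \<and> p$2 = 0}
     else {p. (p$2)\<^sup>2 / (b - a) + (p$3)\<^sup>2 / (c - a) = 1 \<and> p$1 = 0})"

definition real_curve :: "(real^3) set \<Rightarrow> bool" where
  "real_curve \<gamma> \<longleftrightarrow> \<gamma> \<noteq> {}"

definition imaginary_curve :: "(real^3) set \<Rightarrow> bool" where
  "imaginary_curve \<gamma> \<longleftrightarrow> \<gamma> = {}"

definition cone_from :: "real^3 \<Rightarrow> (real^3) set \<Rightarrow> (real^3) set" where
  "cone_from u \<gamma> = closure (\<Union>p\<in>\<gamma> - {u}. affine hull {u, p})"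

definition circular_cone :: "real^3 \<Rightarrow> real^3 \<Rightarrow> real \<Rightarrow> (real^3) set" where
  "circular_cone u r \<theta> =
    {x. (x - u) \<bullet> (((columnvector r :: real^1^3) ** (rowvector r :: real^3^1)
                    - (cos \<theta>)\<^sup>2 *\<^sub>R mat 1) *v (x - u)) = 0}"

(* For \<theta> = pi/2 this is a plane. So the cone to a conic from a point that lies inside it, in its
   own plane, is circular too: it is the whole plane of the conic. *)
definition is_circular_cone :: "real^3 \<Rightarrow> real^3 \<Rightarrow> real \<Rightarrow> (real^3) set \<Rightarrow> bool" where
  "is_circular_cone u r \<theta> S \<longleftrightarrow>
    norm r = 1 \<and> 0 \<le> \<theta> \<and> \<theta> \<le> pi/2 \<and> S = circular_cone u r \<theta>"

definition circular_from :: "real^3 \<Rightarrow> (real^3) set \<Rightarrow> bool" where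
  "circular_from u S \<longleftrightarrow> (\<exists>r \<theta>. is_circular_cone u r \<theta> S)"

definition symmetry_axis :: "real^3 \<Rightarrow> real^3 \<Rightarrow> (real^3) set" where
  "symmetry_axis u r = {u + t *\<^sub>R r | t. True}"

(* v is the velocity at u of some path running in \<gamma>; constant paths give v = 0. *)
definition tangent_vector :: "(real^3) set \<Rightarrow> real^3 \<Rightarrow> real^3 \<Rightarrow> bool" where
  "tangent_vector \<gamma> u v \<longleftrightarrow>
    (\<exists>g e. e > 0 \<and> (\<forall>t. \<bar>t\<bar> < e \<longrightarrow> g t \<in> \<gamma>) \<and> g 0 = u \<and> (g has_vector_derivative v) (at (0::real)))"

(* The affine tangent space; a line at every point of a regular curve. *)
definition tangent_line :: "(real^3) set \<Rightarrow> real^3 \<Rightarrow> (real^3) set" where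
  "tangent_line \<gamma> u = {u + v | v. tangent_vector \<gamma> u v}"

end

theory Submission
  imports Defs
begin

text \<open>
  Write \<open>e\<^sub>1, e\<^sub>2, e\<^sub>3\<close> for \<open>a, b, c\<close>. The curve in the plane \<open>p\<^sub>k = 0\<close> is
  \<open>(\<Sum>n\<noteq>k. p\<^sub>n\<^sup>2 / (e\<^sub>n - e\<^sub>k)) = 1\<close>, so all three curves are treated at once by permuting indices.
  It is empty exactly when \<open>e\<^sub>k\<close> is the largest of the three numbers, say \<open>k = m\<close>; the other two
  curves \<open>i\<close> and \<open>k\<close> form a pair of focal conics.

  \<^emph>\<open>Points on the other curve.\<close> Intersecting the line through \<open>u\<close> in direction \<open>d\<close> with the
  plane \<open>p\<^sub>k = 0\<close> shows that the cone from \<open>u\<close> to the curve \<open>k\<close> is the zero set of a quadratic form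
  in \<open>d\<close> (lemma \<open>cone_from_central_conic\<close>). For \<open>u\<close> on the curve \<open>i\<close> this form is, up to a factor,
  \<open>(q \<bullet> d)\<^sup>2 - C (d \<bullet> d)\<close>, where \<open>q\<close> is tangent to the curve \<open>i\<close> at \<open>u\<close> and
  \<open>0 \<le> C < q \<bullet> q\<close>; this is a circular cone around the tangent line (lemma \<open>focal_cone_circular\<close>).
  A circular cone of positive aperture determines its axis (lemma \<open>circular_cone_axis_unique\<close>),
  so every representation of the cone has the same axis.

  \<^emph>\<open>All other points.\<close> If the cone from \<open>u\<close> to the curve \<open>k\<close> is circular, then the equation of the
  circular cone, restricted to the plane \<open>p\<^sub>k = 0\<close>, is a quadratic polynomial that vanishes on the
  curve, hence is a multiple of the equation of the curve. Comparing coefficients forces the axis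
  to be orthogonal to one of the two principal axes of the conic, and eliminating the axis and the
  aperture leaves exactly the equation of one of the other two curves for \<open>u\<close>, unless the cone is
  the whole plane (lemma \<open>circular_cone_through_conic\<close>).
\<close>

section \<open>Coordinates indexed by a permutation\<close>

lemma UNIV_3_distinct:
  fixes i j k :: 3
  assumes "distinct [i, j, k]"
  shows "UNIV = {i, j, k}"
proof -
  have "card {i, j, k} = CARD(3)"
    using assms by simp
  then show ?thesis
    by (metis card_subset_eq finite subset_UNIV)
qed

lemma inner_3_distinct:
  fixes x y :: "real^3"
  assumes "distinct [i, j, k]"
  shows "x \<bullet> y = x$i * y$i + x$j * y$j + x$k * y$k"
  using assms unfolding inner_vec_def UNIV_3_distinct[OF assms] by simp

lemma vec_eq_3_distinct:
  fixes x y :: "real^3"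
  assumes "distinct [i, j, k]"
  shows "x = y \<longleftrightarrow> x$i = y$i \<and> x$j = y$j \<and> x$k = y$k"
proof -
  have "(\<forall>n. x$n = y$n) \<longleftrightarrow> (\<forall>n\<in>{i, j, k}. x$n = y$n)"
    unfolding UNIV_3_distinct[OF assms, symmetric] by simp
  then show ?thesis by (simp add: vec_eq_iff)
qed

lemma vec_3_exists:
  assumes "distinct [i, j, k]"
  shows "\<exists>x :: real^3. x$i = \<xi> \<and> x$j = \<eta> \<and> x$k = \<zeta>"
  using assms
  by (intro exI[of _ "\<chi> n. if n = i then \<xi> else if n = j then \<eta> else \<zeta>"]) auto

section \<open>Circular cones\<close>

lemma circular_cone_iff:
  "x \<in> circular_cone u r \<theta> \<longleftrightarrow> (r \<bullet> (x - u))\<^sup>2 = (cos \<theta>)\<^sup>2 * ((x - u) \<bullet> (x - u))"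
proof -
  have "d \<bullet> (((columnvector r :: real^1^3) ** (rowvector r :: real^3^1) - C *\<^sub>R mat 1) *v d)
      = (r \<bullet> d)\<^sup>2 - C * (d \<bullet> d)" for d C
    by (simp add: inner_vec_def sum_3 matrix_vector_mult_def matrix_matrix_mult_def
        columnvector_def rowvector_def mat_def power2_eq_square algebra_simps)
  then show ?thesis
    by (simp add: circular_cone_def)
qed

text \<open>
  Intersect the cone with the planes through its axis. For \<open>w\<close> orthogonal to \<open>r\<close>, the directions
  \<open>(cos \<theta> |w|) r \<plusminus> (sin \<theta>) w\<close> lie on the cone; inserting both into the second equation and
  adding shows that \<open>(r' \<bullet> w)\<^sup>2 / |w|\<^sup>2\<close> takes the same value for all \<open>w\<close> orthogonal to \<open>r\<close>. That
  orthogonal complement is two-dimensional, so \<open>r'\<close> is orthogonal to some such \<open>w\<close>, hence to all.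
  For \<open>\<theta> = \<pi>/2\<close> the cone is a plane and the same argument recovers its normal.
\<close>
lemma circular_cone_axis_unique:
  assumes eq: "circular_cone u r \<theta> = circular_cone u r' \<theta>'"
    and r: "norm r = 1" and r': "norm r' = 1" and \<theta>: "(cos \<theta>)\<^sup>2 < 1"
  shows "r' = r \<or> r' = - r"
proof -
  define c s \<rho> v where "c = cos \<theta>" and "s = sin \<theta>" and "\<rho> = r' \<bullet> r" and "v = r' - \<rho> *\<^sub>R r"
  have rr: "r \<bullet> r = 1" and rr': "r' \<bullet> r' = 1"
    using r r' by (simp_all add: norm_eq_1)
  have cs: "c\<^sup>2 + s\<^sup>2 = 1"
    by (simp add: c_def s_def)
  with \<theta> have "s \<noteq> 0"
    by (auto simp: c_def)
  have rv: "r \<bullet> v = 0"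
    by (simp add: v_def \<rho>_def inner_diff_right rr inner_commute)
  have rv': "r' \<bullet> v = v \<bullet> v"
    using rv by (simp add: v_def inner_diff_left inner_commute)
  have key: "(c * \<rho>)\<^sup>2 * (w \<bullet> w) + (s * (r' \<bullet> w))\<^sup>2 = (cos \<theta>')\<^sup>2 * (w \<bullet> w)"
    if w: "r \<bullet> w = 0" for w
  proof -
    define d where "d \<sigma> = (c * norm w) *\<^sub>R r + (\<sigma> * s) *\<^sub>R w" for \<sigma>
    have nw: "(norm w)\<^sup>2 = w \<bullet> w" by (simp add: power2_norm_eq_inner)
    have "(r' \<bullet> d \<sigma>)\<^sup>2 = (cos \<theta>')\<^sup>2 * (w \<bullet> w)" if \<sigma>: "\<sigma>\<^sup>2 = 1" for \<sigma>
    proof -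
      have "d \<sigma> \<bullet> d \<sigma> = (c * norm w)\<^sup>2 + (\<sigma> * s)\<^sup>2 * (w \<bullet> w)"
        using w by (simp add: d_def inner_add_left inner_add_right rr inner_commute power2_eq_square)
      also have "\<dots> = w \<bullet> w"
        using cs \<sigma> by (simp add: power_mult_distrib nw flip: distrib_right)
      finally have dd: "d \<sigma> \<bullet> d \<sigma> = w \<bullet> w" .
      have "r \<bullet> d \<sigma> = c * norm w"
        using w by (simp add: d_def inner_add_right rr)
      then have "u + d \<sigma> \<in> circular_cone u r \<theta>"
        by (simp add: circular_cone_iff dd c_def power_mult_distrib nw)
      then show ?thesis
        unfolding eq by (simp add: circular_cone_iff dd)
    qed
    from this[of 1] this[of "-1"]
    have 1: "(c * norm w * \<rho> + s * (r' \<bullet> w))\<^sup>2 = (cos \<theta>')\<^sup>2 * (w \<bullet> w)"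
      and 2: "(c * norm w * \<rho> - s * (r' \<bullet> w))\<^sup>2 = (cos \<theta>')\<^sup>2 * (w \<bullet> w)"
      by (simp_all add: d_def inner_add_right inner_diff_right \<rho>_def)
    have "(c * norm w * \<rho>)\<^sup>2 + (s * (r' \<bullet> w))\<^sup>2 = (cos \<theta>')\<^sup>2 * (w \<bullet> w)"
      using 1 2 by (simp add: power2_sum power2_diff)
    then show ?thesis
      by (simp add: power_mult_distrib nw algebra_simps)
  qed
  have "v = 0"
  proof (rule ccontr)
    assume "v \<noteq> 0"
    define w where "w = cross3 r v"
    have "w \<bullet> w = v \<bullet> v"
      unfolding w_def using norm_cross_dot[of r v] rr rv
      by (simp add: power_mult_distrib power2_norm_eq_inner)
    moreover have "r \<bullet> w = 0" "v \<bullet> w = 0"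
      by (simp_all add: w_def dot_cross_self)
    moreover have "r' = v + \<rho> *\<^sub>R r"
      by (simp add: v_def)
    ultimately have "(c * \<rho>)\<^sup>2 * (v \<bullet> v) = (cos \<theta>')\<^sup>2 * (v \<bullet> v)"
      using key[of w] by (simp add: inner_add_left)
    with key[OF rv] have "s * (r' \<bullet> v) = 0" by simp
    then show False
      using \<open>s \<noteq> 0\<close> rv' \<open>v \<noteq> 0\<close> by simp
  qed
  then have "r' = \<rho> *\<^sub>R r" by (simp add: v_def)
  moreover have "\<bar>\<rho>\<bar> = 1"
    using r r' calculation by (metis mult.right_neutral norm_scaleR)
  then have "\<rho> = 1 \<or> \<rho> = -1" by linarith
  ultimately show ?thesis by auto
qed

section \<open>Central conics and their tangent lines\<close>

definition central_conic :: "3 \<Rightarrow> 3 \<Rightarrow> 3 \<Rightarrow> real \<Rightarrow> real \<Rightarrow> (real^3) set" where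
  "central_conic i j k \<alpha> \<beta> = {p. p$k = 0 \<and> (p$i)\<^sup>2 / \<alpha> + (p$j)\<^sup>2 / \<beta> = 1}"

lemma central_conic_swap: "central_conic i j k \<alpha> \<beta> = central_conic j i k \<beta> \<alpha>"
  by (auto simp: central_conic_def)

lemma space_curve_central_conic:
  fixes i j k :: 3 and a b c :: real
  assumes "distinct [i, j, k]"
  defines "e \<equiv> ($) (vector [a, b, c] :: real^3)"
  shows "space_curve a b c k = central_conic i j k (e i - e k) (e j - e k)"
  using assms exhaust_3[of i] exhaust_3[of j] exhaust_3[of k]
  by (auto simp: space_curve_def central_conic_def)

text \<open>
  Differentiating the equations of the conic gives the conditions on \<open>v\<close>. Conversely, for any such
  \<open>v\<close> with \<open>\<sigma>\<close> its value under the quadratic form of the conic, the path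
  \<open>t \<mapsto> ((1 - \<sigma>t\<^sup>2/4) u + t v) / (1 + \<sigma>t\<^sup>2/4)\<close> stays on the conic; this rational parametrization
  treats ellipses and hyperbolas alike.
\<close>
lemma tangent_vector_central_conic_iff:
  assumes u: "u \<in> central_conic i j k \<alpha> \<beta>"
  shows "tangent_vector (central_conic i j k \<alpha> \<beta>) u v \<longleftrightarrow>
    v$k = 0 \<and> u$i * v$i / \<alpha> + u$j * v$j / \<beta> = 0"
proof
  assume "tangent_vector (central_conic i j k \<alpha> \<beta>) u v"
  then obtain g \<epsilon> where \<epsilon>: "\<epsilon> > 0" and g: "\<And>t. \<bar>t\<bar> < \<epsilon> \<Longrightarrow> g t \<in> central_conic i j k \<alpha> \<beta>"
    and g0: "g 0 = u" and deriv: "(g has_vector_derivative v) (at 0)"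
    unfolding tangent_vector_def by blast
  have near: "\<forall>\<^sub>F t in nhds (0::real). g t \<in> central_conic i j k \<alpha> \<beta>"
    unfolding eventually_nhds_metric using \<epsilon> g by (auto simp: dist_real_def)
  have comp: "((\<lambda>t. g t $ n) has_real_derivative v $ n) (at 0)" for n
    using bounded_linear.has_vector_derivative[OF bounded_linear_vec_nth deriv, of n]
    by (simp add: has_real_derivative_iff_has_vector_derivative)
  have zero: "D = 0" if "(f has_real_derivative D) (at 0)" "\<forall>\<^sub>F t in nhds (0::real). f t = C"
    for f :: "real \<Rightarrow> real" and D C
  proof -
    have "((\<lambda>t. C) has_real_derivative D) (at 0)"
      using DERIV_cong_ev[OF refl that(2) refl, of D] that(1) by simp
    then show ?thesis using DERIV_const DERIV_unique by blast
  qed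
  have sq: "((\<lambda>t. (g t $ n)\<^sup>2 / \<kappa>) has_real_derivative 2 * (u$n * v$n / \<kappa>)) (at 0)" for n \<kappa>
    using DERIV_cdivide[OF DERIV_power[OF comp[of n], of 2], of \<kappa>]
    by (simp add: g0 mult.commute[of "v$n"])
  have "v$k = 0"
    by (rule zero[OF comp]) (use near in \<open>auto simp: central_conic_def elim!: eventually_mono\<close>)
  moreover have "2 * (u$i * v$i / \<alpha>) + 2 * (u$j * v$j / \<beta>) = 0"
  proof (rule zero)
    show "((\<lambda>t. (g t $ i)\<^sup>2 / \<alpha> + (g t $ j)\<^sup>2 / \<beta>) has_real_derivative
        2 * (u$i * v$i / \<alpha>) + 2 * (u$j * v$j / \<beta>)) (at 0)"
      by (intro DERIV_add sq)
    show "\<forall>\<^sub>F t in nhds 0. (g t $ i)\<^sup>2 / \<alpha> + (g t $ j)\<^sup>2 / \<beta> = 1"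
      using near by (auto simp: central_conic_def elim!: eventually_mono)
  qed
  then have "u$i * v$i / \<alpha> + u$j * v$j / \<beta> = 0"
    by (metis distrib_left mult_eq_0_iff zero_neq_numeral)
  ultimately show "v$k = 0 \<and> u$i * v$i / \<alpha> + u$j * v$j / \<beta> = 0"
    by simp
next
  assume v: "v$k = 0 \<and> u$i * v$i / \<alpha> + u$j * v$j / \<beta> = 0"
  define \<sigma> where "\<sigma> = (v$i)\<^sup>2 / \<alpha> + (v$j)\<^sup>2 / \<beta>"
  define g where "g t = inverse (1 + \<sigma> * t\<^sup>2 / 4) *\<^sub>R ((1 - \<sigma> * t\<^sup>2 / 4) *\<^sub>R u + t *\<^sub>R v)" for t
  have "(\<lambda>t. 1 + \<sigma> * t\<^sup>2 / 4) \<midarrow>0\<rightarrow> 1 + \<sigma> * 0\<^sup>2 / 4"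
    by (intro tendsto_intros) simp
  then have "\<forall>\<^sub>F t in at 0. 1 + \<sigma> * t\<^sup>2 / 4 > 0"
    by (rule order_tendstoD) simp
  then obtain \<epsilon> where \<epsilon>: "\<epsilon> > 0" and pos: "\<And>t. t \<noteq> 0 \<Longrightarrow> \<bar>t\<bar> < \<epsilon> \<Longrightarrow> 1 + \<sigma> * t\<^sup>2 / 4 > 0"
    unfolding eventually_at by (auto simp: dist_real_def)
  have "g t \<in> central_conic i j k \<alpha> \<beta>" if "\<bar>t\<bar> < \<epsilon>" for t
  proof -
    define q where "q = 1 + \<sigma> * t\<^sup>2 / 4"
    have q: "q > 0" using pos[of t] that by (cases "t = 0") (auto simp: q_def)
    have u1: "(u$i)\<^sup>2 / \<alpha> + (u$j)\<^sup>2 / \<beta> = 1" using u by (simp add: central_conic_def)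
    have gn: "g t $ n = ((2 - q) * u$n + t * v$n) / q" for n
    proof -
      have "g t = inverse q *\<^sub>R ((2 - q) *\<^sub>R u + t *\<^sub>R v)"
        by (simp add: g_def q_def)
      then show ?thesis by (simp add: divide_inverse mult.commute)
    qed
    have square: "(h * x + t * y)\<^sup>2 / \<kappa> = h\<^sup>2 * (x\<^sup>2 / \<kappa>) + 2 * h * t * (x * y / \<kappa>) + t\<^sup>2 * (y\<^sup>2 / \<kappa>)"
      for h x y \<kappa> :: real
    proof -
      have "(h * x + t * y)\<^sup>2 = h\<^sup>2 * x\<^sup>2 + 2 * h * t * (x * y) + t\<^sup>2 * y\<^sup>2" by algebra
      then show ?thesis by (simp add: add_divide_distrib)
    qed
    have \<sigma>q: "\<sigma> * t\<^sup>2 = 4 * q - 4" by (simp add: q_def)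
    have "((2 - q) * u$i + t * v$i)\<^sup>2 / \<alpha> + ((2 - q) * u$j + t * v$j)\<^sup>2 / \<beta>
        = (2 - q)\<^sup>2 * ((u$i)\<^sup>2 / \<alpha> + (u$j)\<^sup>2 / \<beta>)
          + 2 * (2 - q) * t * (u$i * v$i / \<alpha> + u$j * v$j / \<beta>) + \<sigma> * t\<^sup>2"
      unfolding square \<sigma>_def by (simp add: algebra_simps)
    also have "\<dots> = q\<^sup>2"
      unfolding u1 \<sigma>q using v by (simp add: power2_eq_square algebra_simps)
    finally have E: "((2 - q) * u$i + t * v$i)\<^sup>2 / \<alpha> + ((2 - q) * u$j + t * v$j)\<^sup>2 / \<beta> = q\<^sup>2" .
    have scale: "(y / q)\<^sup>2 / \<kappa> = y\<^sup>2 / \<kappa> / q\<^sup>2" for y \<kappa> :: real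
      by (simp add: power_divide)
    have "(g t $ i)\<^sup>2 / \<alpha> + (g t $ j)\<^sup>2 / \<beta>
        = (((2 - q) * u$i + t * v$i)\<^sup>2 / \<alpha> + ((2 - q) * u$j + t * v$j)\<^sup>2 / \<beta>) / q\<^sup>2"
      unfolding gn scale by (rule add_divide_distrib[symmetric])
    also have "\<dots> = 1"
      unfolding E using q by simp
    finally have "(g t $ i)\<^sup>2 / \<alpha> + (g t $ j)\<^sup>2 / \<beta> = 1" .
    moreover have "g t $ k = 0"
      using u v by (simp add: gn central_conic_def)
    ultimately show ?thesis by (simp add: central_conic_def)
  qed
  moreover have "g 0 = u" by (simp add: g_def)
  moreover have "(g has_vector_derivative v) (at 0)"
    unfolding g_def by (auto intro!: derivative_eq_intros)
  ultimately show "tangent_vector (central_conic i j k \<alpha> \<beta>) u v"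
    unfolding tangent_vector_def using \<epsilon> by blast
qed

section \<open>The cone over a central conic\<close>

lemma cone_from_direction:
  assumes p: "p \<in> \<gamma>" and u: "u \<notin> \<gamma>"
  shows "u + t *\<^sub>R (p - u) \<in> cone_from u \<gamma>"
proof -
  have "u + t *\<^sub>R (p - u) \<in> affine hull {u, p}"
    unfolding affine_hull_2_alt by blast
  moreover have "p \<in> \<gamma> - {u}" using p u by auto
  ultimately show ?thesis
    unfolding cone_from_def by (meson UN_I closure_subset subsetD)
qed

lemma cone_from_subset:
  assumes "closed S" and "\<And>p t. p \<in> \<gamma> \<Longrightarrow> u + t *\<^sub>R (p - u) \<in> S"
  shows "cone_from u \<gamma> \<subseteq> S"
  unfolding cone_from_def
  by (rule closure_minimal) (use assms in \<open>auto simp: affine_hull_2_alt\<close>)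

text \<open>
  An asymptotic direction \<open>d\<close> of a hyperbola is reached as a limit: if \<open>w\<close> is the other asymptotic
  direction, scaled so that \<open>d\<close> and \<open>w\<close> pair to \<open>1/2\<close>, then \<open>d / t + t w\<close> runs through the hyperbola,
  and the line from \<open>u\<close> to this point has the direction \<open>d + t\<^sup>2 w - t u\<close>, which tends to \<open>d\<close> as
  \<open>t\<close> tends to \<open>0\<close>.
\<close>
lemma cone_from_asymptote:
  assumes dist: "distinct [i, j, k]" and u: "u \<notin> central_conic i j k \<alpha> \<beta>"
    and \<alpha>: "\<alpha> \<noteq> 0" and dk: "d$k = 0" and d: "(d$i)\<^sup>2 / \<alpha> + (d$j)\<^sup>2 / \<beta> = 0" and di: "d$i \<noteq> 0"
  shows "u + d \<in> cone_from u (central_conic i j k \<alpha> \<beta>)"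
proof -
  obtain w :: "real^3" where w: "w$i = \<alpha> / (4 * d$i)" "w$j = - (\<alpha> * d$j / (4 * (d$i)\<^sup>2))" "w$k = 0"
    using vec_3_exists[OF dist] by blast
  have ww: "(w$i)\<^sup>2 / \<alpha> + (w$j)\<^sup>2 / \<beta> = 0"
  proof -
    have "(w$i)\<^sup>2 / \<alpha> + (w$j)\<^sup>2 / \<beta> = (\<alpha> / (4 * (d$i)\<^sup>2))\<^sup>2 * ((d$i)\<^sup>2 / \<alpha> + (d$j)\<^sup>2 / \<beta>)"
      unfolding w using di by (simp add: power2_eq_square distrib_left)
    then show ?thesis using d by simp
  qed
  have dw: "d$i * w$i / \<alpha> + d$j * w$j / \<beta> = 1/2"
  proof -
    have "d$j * w$j / \<beta> = - (\<alpha> / (4 * (d$i)\<^sup>2)) * ((d$j)\<^sup>2 / \<beta>)"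
      unfolding w by (simp add: power2_eq_square)
    also have "(d$j)\<^sup>2 / \<beta> = - ((d$i)\<^sup>2 / \<alpha>)" using d by simp
    also have "- (\<alpha> / (4 * (d$i)\<^sup>2)) * - ((d$i)\<^sup>2 / \<alpha>) = 1/4"
      using di \<alpha> by simp
    finally have "d$j * w$j / \<beta> = 1/4" .
    moreover have "d$i * w$i / \<alpha> = 1/4"
      using di \<alpha> by (simp add: w)
    ultimately show ?thesis by linarith
  qed
  have "u + (d + t\<^sup>2 *\<^sub>R w - t *\<^sub>R u) \<in> cone_from u (central_conic i j k \<alpha> \<beta>)" if t: "t \<noteq> 0" for t
  proof -
    define p where "p = inverse t *\<^sub>R d + t *\<^sub>R w"
    have "(p$i)\<^sup>2 / \<alpha> + (p$j)\<^sup>2 / \<beta> = (inverse t)\<^sup>2 * ((d$i)\<^sup>2 / \<alpha> + (d$j)\<^sup>2 / \<beta>)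
        + 2 * (inverse t * t) * (d$i * w$i / \<alpha> + d$j * w$j / \<beta>) + t\<^sup>2 * ((w$i)\<^sup>2 / \<alpha> + (w$j)\<^sup>2 / \<beta>)"
      by (simp add: p_def power2_eq_square algebra_simps add_divide_distrib)
    then have "p \<in> central_conic i j k \<alpha> \<beta>"
      using t d dw ww dk w by (simp add: central_conic_def p_def)
    then have "u + t *\<^sub>R (p - u) \<in> cone_from u (central_conic i j k \<alpha> \<beta>)"
      using cone_from_direction u by blast
    then show ?thesis
      using t by (simp add: p_def algebra_simps power2_eq_square)
  qed
  then have "\<forall>\<^sub>F t in at 0. u + (d + t\<^sup>2 *\<^sub>R w - t *\<^sub>R u) \<in> cone_from u (central_conic i j k \<alpha> \<beta>)"
    by (simp add: eventually_at_filter)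
  moreover have "((\<lambda>t::real. u + (d + t\<^sup>2 *\<^sub>R w - t *\<^sub>R u)) \<longlongrightarrow> u + (d + 0\<^sup>2 *\<^sub>R w - 0 *\<^sub>R u)) (at 0)"
    by (intro tendsto_intros)
  moreover have "closed (cone_from u (central_conic i j k \<alpha> \<beta>))"
    by (simp add: cone_from_def)
  ultimately show ?thesis
    using Lim_in_closed_set[of "cone_from u (central_conic i j k \<alpha> \<beta>)" _ "at (0::real)"] by fastforce
qed

text \<open>
  If \<open>u\<close> is off the plane of the conic, the line through \<open>u\<close> in direction \<open>d\<close> meets that plane at
  the point with coordinates \<open>(u\<^sub>n d\<^sub>k - u\<^sub>k d\<^sub>n) / d\<^sub>k\<close>, and the equation of the cone says that this
  point lies on the conic; for \<open>d\<^sub>k = 0\<close> it says that \<open>d\<close> is an asymptotic direction.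

  A focal conic meets the plane of the other conic only in foci of the latter, and for a focus the
  equation remains correct. Both sides are then the whole plane: the equation collapses to \<open>d\<^sub>k = 0\<close>, and
  every line in the plane through a focus meets the conic or is parallel to an asymptote.
\<close>
lemma cone_from_central_conic:
  assumes dist: "distinct [i, j, k]" and \<alpha>: "\<alpha> > 0" and \<beta>: "\<beta> \<noteq> 0"
    and u: "u \<notin> central_conic i j k \<alpha> \<beta>"
    and ne: "central_conic i j k \<alpha> \<beta> \<noteq> {}"
    and focus: "u$k = 0 \<longrightarrow> u$j = 0 \<and> (u$i)\<^sup>2 = \<alpha> - \<beta>"
  shows "cone_from u (central_conic i j k \<alpha> \<beta>) =
    {x. let d = x - u in
      (u$i * d$k - u$k * d$i)\<^sup>2 / \<alpha> + (u$j * d$k - u$k * d$j)\<^sup>2 / \<beta> = (d$k)\<^sup>2}"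
    (is "cone_from u ?\<gamma> = ?S")
proof
  show "cone_from u ?\<gamma> \<subseteq> ?S"
  proof (rule cone_from_subset)
    show "closed ?S"
      unfolding Let_def using \<alpha> \<beta> by (intro closed_Collect_eq continuous_intros) auto
    fix p t assume p: "p \<in> ?\<gamma>"
    then have det: "u$n * (t *\<^sub>R (p - u))$k - u$k * (t *\<^sub>R (p - u))$n = - (t * u$k) * p$n" for n
      by (simp add: central_conic_def algebra_simps)
    have "(u$i * (t *\<^sub>R (p - u))$k - u$k * (t *\<^sub>R (p - u))$i)\<^sup>2 / \<alpha>
        + (u$j * (t *\<^sub>R (p - u))$k - u$k * (t *\<^sub>R (p - u))$j)\<^sup>2 / \<beta>
        = (t * u$k)\<^sup>2 * ((p$i)\<^sup>2 / \<alpha> + (p$j)\<^sup>2 / \<beta>)"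
      unfolding det by (simp add: power_mult_distrib distrib_left)
    also have "\<dots> = ((t *\<^sub>R (p - u))$k)\<^sup>2"
      using p by (simp add: central_conic_def power_mult_distrib)
    finally show "u + t *\<^sub>R (p - u) \<in> ?S"
      by (simp add: Let_def)
  qed
  show "?S \<subseteq> cone_from u ?\<gamma>"
  proof
    fix x assume "x \<in> ?S"
    define d where "d = x - u"
    have Q: "(u$i * d$k - u$k * d$i)\<^sup>2 / \<alpha> + (u$j * d$k - u$k * d$j)\<^sup>2 / \<beta> = (d$k)\<^sup>2"
      using \<open>x \<in> ?S\<close> by (simp add: d_def Let_def)
    have secant: "u + d \<in> cone_from u ?\<gamma>" if "u + t *\<^sub>R d \<in> ?\<gamma>" for t
    proof -
      have "t \<noteq> 0" using that u by auto
      then show ?thesis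
        using cone_from_direction[OF that u, of "inverse t"] by simp
    qed
    have asymptotic: "u + d \<in> cone_from u ?\<gamma>"
      if dk: "d$k = 0" and B: "(d$i)\<^sup>2 / \<alpha> + (d$j)\<^sup>2 / \<beta> = 0"
    proof (cases "d$i = 0")
      case True
      then have "d = 0"
        using B \<beta> dk by (simp add: vec_eq_3_distinct[OF dist])
      moreover obtain p where "p \<in> ?\<gamma>" using ne by blast
      ultimately show ?thesis
        using cone_from_direction[OF _ u, of p 0] by simp
    next
      case False
      then show ?thesis
        using cone_from_asymptote[OF dist u _ dk B] \<alpha> by simp
    qed
    have "u + d \<in> cone_from u ?\<gamma>"
    proof (cases "u$k = 0")
      case False
      show ?thesis
      proof (cases "d$k = 0")
        case True
        then have "(u$k)\<^sup>2 * ((d$i)\<^sup>2 / \<alpha> + (d$j)\<^sup>2 / \<beta>) = 0"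
          using Q by (simp add: power_mult_distrib algebra_simps)
        then show ?thesis
          using asymptotic True False by simp
      next
        case dk: False
        define t where "t = - (u$k / d$k)"
        have pn: "(u + t *\<^sub>R d)$n = (u$n * d$k - u$k * d$n) / d$k" for n
          using dk by (simp add: t_def field_simps)
        have "((u + t *\<^sub>R d)$i)\<^sup>2 / \<alpha> + ((u + t *\<^sub>R d)$j)\<^sup>2 / \<beta>
            = ((u$i * d$k - u$k * d$i)\<^sup>2 / \<alpha> + (u$j * d$k - u$k * d$j)\<^sup>2 / \<beta>) / (d$k)\<^sup>2"
          unfolding pn by (simp add: power_divide add_divide_distrib mult.commute)
        also have "\<dots> = 1"
          unfolding Q using dk by simp
        moreover have "(u + t *\<^sub>R d)$k = 0"
          using pn[of k] by simp
        ultimately have "u + t *\<^sub>R d \<in> ?\<gamma>"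
          using dk by (simp add: central_conic_def)
        then show ?thesis by (rule secant)
      qed
    next
      case uk: True
      then have uj: "u$j = 0" and ui: "(u$i)\<^sup>2 = \<alpha> - \<beta>" using focus by auto
      have "\<beta> * (d$k)\<^sup>2 = 0"
      proof -
        have "(\<alpha> - \<beta>) * (d$k)\<^sup>2 / \<alpha> = (d$k)\<^sup>2"
          using Q uk uj by (simp add: power_mult_distrib ui)
        then show ?thesis using \<alpha> by (simp add: field_simps)
      qed
      then have dk: "d$k = 0" using \<beta> by simp
      show ?thesis
      proof (cases "(d$i)\<^sup>2 / \<alpha> + (d$j)\<^sup>2 / \<beta> = 0")
        case True
        then show ?thesis using asymptotic dk by simp
      next
        case False
        \<comment> \<open>Now \<open>u + t d\<close> lies on the conic iff \<open>P t\<^sup>2 + 2 (u\<^sub>i d\<^sub>i / \<alpha>) t = \<beta> / \<alpha>\<close>. At a focus the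
          reduced discriminant of this quadratic equation is \<open>(d\<^sub>i\<^sup>2 + d\<^sub>j\<^sup>2) / \<alpha>\<close>, which is
          nonnegative, and \<open>R\<close> is its square root.\<close>
        define P where "P = (d$i)\<^sup>2 / \<alpha> + (d$j)\<^sup>2 / \<beta>"
        define R where "R = sqrt (((d$i)\<^sup>2 + (d$j)\<^sup>2) / \<alpha>)"
        define t where "t = (R - u$i * d$i / \<alpha>) / P"
        have P: "P \<noteq> 0" using False by (simp add: P_def)
        then have tP: "t * P = R - u$i * d$i / \<alpha>" by (simp add: t_def)
        have "R\<^sup>2 = ((d$i)\<^sup>2 + (d$j)\<^sup>2) / \<alpha>"
          using \<alpha> by (simp add: R_def)
        also have "\<dots> = (\<alpha> - \<beta>) * (d$i)\<^sup>2 / \<alpha>\<^sup>2 + P * (\<beta> / \<alpha>)"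
          using \<alpha> \<beta> by (simp add: P_def field_simps power2_eq_square)
        also have "(\<alpha> - \<beta>) * (d$i)\<^sup>2 / \<alpha>\<^sup>2 = (u$i * d$i / \<alpha>)\<^sup>2"
          by (simp add: power_mult_distrib power_divide ui)
        finally have R2: "R\<^sup>2 = (u$i * d$i / \<alpha>)\<^sup>2 + P * (\<beta> / \<alpha>)" .
        have "P * ((u$i + t * d$i)\<^sup>2 / \<alpha> + (t * d$j)\<^sup>2 / \<beta>)
            = P * (u$i)\<^sup>2 / \<alpha> + 2 * (t * P) * (u$i * d$i / \<alpha>) + (t * P)\<^sup>2"
          by (simp add: P_def power2_eq_square algebra_simps add_divide_distrib)
        also have "\<dots> = P * (u$i)\<^sup>2 / \<alpha> + R\<^sup>2 - (u$i * d$i / \<alpha>)\<^sup>2"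
          unfolding tP by (simp add: power2_eq_square algebra_simps)
        also have "\<dots> = P"
          unfolding R2 ui using \<alpha> by (simp add: field_simps)
        finally have "(u$i + t * d$i)\<^sup>2 / \<alpha> + (t * d$j)\<^sup>2 / \<beta> = 1"
          using P by simp
        then have "u + t *\<^sub>R d \<in> ?\<gamma>"
          using uk uj dk by (simp add: central_conic_def)
        then show ?thesis by (rule secant)
      qed
    qed
    then show "x \<in> cone_from u ?\<gamma>" by (simp add: d_def)
  qed
qed

section \<open>Real and imaginary curves\<close>

lemma central_conic_radius_pos:
  assumes "central_conic i j k \<alpha> \<beta> \<noteq> {}"
  shows "\<alpha> > 0 \<or> \<beta> > 0"
proof (rule ccontr)
  assume "\<not> ?thesis"
  then have "(p$i)\<^sup>2 / \<alpha> + (p$j)\<^sup>2 / \<beta> \<le> 0" for p :: "real^3"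
    by (intro add_nonpos_nonpos divide_nonneg_nonpos) auto
  moreover obtain p where "p \<in> central_conic i j k \<alpha> \<beta>" using assms by blast
  ultimately show False
    by (metis (mono_tags, lifting) central_conic_def mem_Collect_eq not_one_le_zero)
qed

lemma central_conic_nonempty:
  assumes dist: "distinct [i, j, k]" and \<alpha>: "\<alpha> > 0"
  shows "central_conic i j k \<alpha> \<beta> \<noteq> {}"
proof -
  obtain p :: "real^3" where "p$i = sqrt \<alpha>" "p$j = 0" "p$k = 0"
    using vec_3_exists[OF dist] by blast
  then have "p \<in> central_conic i j k \<alpha> \<beta>"
    using \<alpha> by (simp add: central_conic_def)
  then show ?thesis by blast
qed

lemma real_space_curve_iff:
  fixes i j k :: 3 and a b c :: real
  assumes dist: "distinct [i, j, k]"
  defines "e \<equiv> ($) (vector [a, b, c] :: real^3)"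
  shows "real_curve (space_curve a b c k) \<longleftrightarrow> e k < e i \<or> e k < e j"
proof -
  have dist': "distinct [j, i, k]" using dist by auto
  show ?thesis
    using central_conic_radius_pos[of i j k "e i - e k" "e j - e k"]
      central_conic_nonempty[OF dist, of "e i - e k" "e j - e k"]
      central_conic_nonempty[OF dist', of "e j - e k" "e i - e k"]
    unfolding real_curve_def space_curve_central_conic[OF dist] e_def central_conic_swap[of j i]
    by auto
qed

section \<open>Circular cones through a conic\<close>

text \<open>
  The conic is symmetric under both reflections, so the four points \<open>(\<plusminus>x, \<plusminus>y)\<close> with \<open>x, y \<noteq> 0\<close>
  eliminate the terms that are odd in \<open>x\<close> or \<open>y\<close>. What remains is affine in \<open>\<tau> = y\<^sup>2 / |\<beta>|\<close> along
  the conic and vanishes for two values of \<open>\<tau>\<close>, hence identically.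
\<close>
lemma quadratic_vanishing_on_conic:
  fixes \<alpha> \<beta> :: real
  assumes \<alpha>: "\<alpha> > 0" and \<beta>: "\<beta> \<noteq> 0"
    and van: "\<And>x y. x\<^sup>2 / \<alpha> + y\<^sup>2 / \<beta> = 1 \<Longrightarrow> A * x\<^sup>2 + B * y\<^sup>2 + C * (x * y) + D * x + E * y + F = 0"
  shows "C = 0" "D = 0" "E = 0" "A * \<alpha> = - F" "B * \<beta> = - F"
proof -
  \<comment> \<open>For \<open>0 < \<tau> < 1\<close> the point is real whatever the sign of \<open>\<beta>\<close>.\<close>
  have pt: "\<exists>x y. x \<noteq> 0 \<and> y \<noteq> 0 \<and> x\<^sup>2 = \<alpha> * (1 - \<tau> * sgn \<beta>) \<and> y\<^sup>2 = \<tau> * \<bar>\<beta>\<bar> \<and>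
      A * x\<^sup>2 + B * y\<^sup>2 + F = 0 \<and> C * (x * y) = 0 \<and> D * x = 0 \<and> E * y = 0"
    if \<tau>: "0 < \<tau>" "\<tau> < 1" for \<tau>
  proof -
    define x y where "x = sqrt (\<alpha> * (1 - \<tau> * sgn \<beta>))" and "y = sqrt (\<tau> * \<bar>\<beta>\<bar>)"
    have "\<tau> * sgn \<beta> < 1"
      using \<tau> by (simp add: sgn_if)
    then have pos: "\<alpha> * (1 - \<tau> * sgn \<beta>) > 0" using \<alpha> by simp
    then have x: "x \<noteq> 0" "x\<^sup>2 = \<alpha> * (1 - \<tau> * sgn \<beta>)"
      using \<alpha> \<open>\<tau> * sgn \<beta> < 1\<close> by (auto simp: x_def)
    have y: "y \<noteq> 0" "y\<^sup>2 = \<tau> * \<bar>\<beta>\<bar>" using \<tau> \<beta> by (simp_all add: y_def)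
    have "x\<^sup>2 / \<alpha> + y\<^sup>2 / \<beta> = 1"
      using \<alpha> \<beta> by (simp add: x y sgn_if)
    then have "A * x\<^sup>2 + B * y\<^sup>2 + C * (x * y) + D * x + E * y + F = 0"
      "A * x\<^sup>2 + B * y\<^sup>2 - C * (x * y) - D * x + E * y + F = 0"
      "A * x\<^sup>2 + B * y\<^sup>2 - C * (x * y) + D * x - E * y + F = 0"
      "A * x\<^sup>2 + B * y\<^sup>2 + C * (x * y) - D * x - E * y + F = 0"
      using van[of x y] van[of "- x" y] van[of x "- y"] van[of "- x" "- y"] by simp_all
    then have "A * x\<^sup>2 + B * y\<^sup>2 + F = 0 \<and> C * (x * y) = 0 \<and> D * x = 0 \<and> E * y = 0"
      by linarith
    then show ?thesis using x y by blast
  qed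
  obtain x y where xy: "x \<noteq> 0" "y \<noteq> 0" "x\<^sup>2 = \<alpha> * (1 - 1/2 * sgn \<beta>)" "y\<^sup>2 = 1/2 * \<bar>\<beta>\<bar>"
      "A * x\<^sup>2 + B * y\<^sup>2 + F = 0" "C * (x * y) = 0" "D * x = 0" "E * y = 0"
    using pt[of "1/2"] by auto
  then show "C = 0" "D = 0" "E = 0" by auto
  obtain x' y' where xy': "x'\<^sup>2 = \<alpha> * (1 - 1/4 * sgn \<beta>)" "y'\<^sup>2 = 1/4 * \<bar>\<beta>\<bar>"
      "A * x'\<^sup>2 + B * y'\<^sup>2 + F = 0"
    using pt[of "1/4"] by auto
  have lin: "A * \<alpha> + F + \<tau> * (B * \<bar>\<beta>\<bar> - A * \<alpha> * sgn \<beta>) = A * (\<alpha> * (1 - \<tau> * sgn \<beta>)) + B * (\<tau> * \<bar>\<beta>\<bar>) + F" for \<tau>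
    by (simp add: algebra_simps)
  have "A * \<alpha> + F + 1/2 * (B * \<bar>\<beta>\<bar> - A * \<alpha> * sgn \<beta>) = 0" "A * \<alpha> + F + 1/4 * (B * \<bar>\<beta>\<bar> - A * \<alpha> * sgn \<beta>) = 0"
    unfolding lin using xy(5) xy'(3) unfolding xy(3,4) xy'(1,2) by simp_all
  then have "A * \<alpha> + F = 0" and eq: "B * \<bar>\<beta>\<bar> = A * \<alpha> * sgn \<beta>" by argo+
  then show "A * \<alpha> = - F" by simp
  have "B * \<beta> = A * \<alpha>"
    using eq \<beta> by (cases "\<beta> > 0") (auto simp: sgn_if)
  then show "B * \<beta> = - F" using \<open>A * \<alpha> + F = 0\<close> by simp
qed

text \<open>
  On the plane of the conic the equation of the circular cone is a quadratic polynomial whose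
  mixed coefficient is \<open>2 r\<^sub>i r\<^sub>j\<close>. So at most one of \<open>r\<^sub>i\<close> and \<open>r\<^sub>j\<close> is nonzero. If one is, the
  remaining coefficient identities give the equation of a focal conic for \<open>u\<close>. If neither is, the
  conic would be a circle unless \<open>cos \<theta> = 0\<close>, and the cone is a plane.
\<close>
lemma circular_cone_through_conic:
  assumes dist: "distinct [i, j, k]" and \<alpha>: "\<alpha> > 0" and \<beta>: "\<beta> \<noteq> 0" and \<alpha>\<beta>: "\<alpha> \<noteq> \<beta>"
    and r: "norm r = 1" and sub: "central_conic i j k \<alpha> \<beta> \<subseteq> circular_cone u r \<theta>"
  shows "u \<in> central_conic i k j (\<alpha> - \<beta>) (- \<beta>) \<or> u \<in> central_conic j k i (\<beta> - \<alpha>) (- \<alpha>) \<or>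
    circular_cone u r \<theta> = {x. x$k = 0}"
proof -
  define C \<rho> where "C = (cos \<theta>)\<^sup>2" and "\<rho> = r \<bullet> u"
  note ip = inner_3_distinct[OF dist]
  have van: "((r$i)\<^sup>2 - C) * x\<^sup>2 + ((r$j)\<^sup>2 - C) * y\<^sup>2 + (2 * r$i * r$j) * (x * y)
      + (2 * (C * u$i - r$i * \<rho>)) * x + (2 * (C * u$j - r$j * \<rho>)) * y + (\<rho>\<^sup>2 - C * (u \<bullet> u)) = 0"
    if xy: "x\<^sup>2 / \<alpha> + y\<^sup>2 / \<beta> = 1" for x y
  proof -
    obtain p :: "real^3" where p: "p$i = x" "p$j = y" "p$k = 0"
      using vec_3_exists[OF dist] by blast
    then have "p \<in> circular_cone u r \<theta>"
      using sub xy by (auto simp: central_conic_def)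
    then have "(r \<bullet> p - \<rho>)\<^sup>2 = C * (p \<bullet> p - 2 * (u \<bullet> p) + u \<bullet> u)"
      by (simp add: circular_cone_iff C_def \<rho>_def inner_diff_right inner_diff_left inner_commute)
    then show ?thesis
      unfolding ip[of _ p] p by (simp add: power2_eq_square algebra_simps)
  qed
  note coeffs = quadratic_vanishing_on_conic[OF \<alpha> \<beta> van]
  \<comment> \<open>The elimination common to both cases: \<open>t\<close> is the nonzero one of \<open>r\<^sub>i, r\<^sub>j\<close>, and \<open>s\<close>, \<open>v\<close> are the
    coordinates of \<open>u\<close> with the same and with the opposite index.\<close>
  have on_focal: "v = 0 \<and> s\<^sup>2 / (\<alpha>' - \<beta>') + (u$k)\<^sup>2 / (- \<beta>') = 1"
    if "t \<noteq> 0" "\<alpha>' \<noteq> 0" "\<beta>' \<noteq> 0" "\<alpha>' \<noteq> \<beta>'" and t: "(t\<^sup>2 - C) * \<alpha>' = - (C * \<beta>')"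
      and s: "C * s = t * \<rho>" and v: "C * v = 0" and F: "\<rho>\<^sup>2 - C * (s\<^sup>2 + v\<^sup>2 + (u$k)\<^sup>2) = C * \<beta>'"
    for s t v \<alpha>' \<beta>'
  proof -
    have C: "C \<noteq> 0" using t that(1,2) by auto
    then have v0: "v = 0" using v by simp
    have ta: "t\<^sup>2 * \<alpha>' = C * (\<alpha>' - \<beta>')" using t by (simp add: algebra_simps)
    have "(C * s)\<^sup>2 * \<alpha>' - C * (s\<^sup>2 + (u$k)\<^sup>2) * (t\<^sup>2 * \<alpha>') = C * \<beta>' * (t\<^sup>2 * \<alpha>')"
      unfolding s using F v0 by (simp add: power_mult_distrib flip: F) (simp add: algebra_simps)
    then have "C\<^sup>2 * (s\<^sup>2 * \<beta>' - (u$k)\<^sup>2 * (\<alpha>' - \<beta>')) = C\<^sup>2 * (\<beta>' * (\<alpha>' - \<beta>'))"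
      unfolding ta by (simp add: power2_eq_square algebra_simps)
    then have "s\<^sup>2 * \<beta>' - (u$k)\<^sup>2 * (\<alpha>' - \<beta>') = \<beta>' * (\<alpha>' - \<beta>')"
      using C by simp
    then show ?thesis
      using v0 that(3,4) by (simp add: field_simps)
  qed
  have uu: "u \<bullet> u = (u$i)\<^sup>2 + (u$j)\<^sup>2 + (u$k)\<^sup>2"
    by (simp add: ip power2_eq_square)
  consider "r$i \<noteq> 0" "r$j = 0" | "r$j \<noteq> 0" "r$i = 0" | "r$i = 0" "r$j = 0"
    using coeffs(1) by fastforce
  then show ?thesis
  proof cases
    case 1
    then have "u$j = 0 \<and> (u$i)\<^sup>2 / (\<alpha> - \<beta>) + (u$k)\<^sup>2 / (- \<beta>) = 1"
      using coeffs \<alpha> \<beta> \<alpha>\<beta> by (intro on_focal[of "r$i"]) (auto simp: uu)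
    then show ?thesis by (simp add: central_conic_def)
  next
    case 2
    then have "u$i = 0 \<and> (u$j)\<^sup>2 / (\<beta> - \<alpha>) + (u$k)\<^sup>2 / (- \<alpha>) = 1"
      using coeffs \<alpha> \<beta> \<alpha>\<beta> by (intro on_focal[of "r$j"]) (auto simp: uu algebra_simps)
    then show ?thesis by (simp add: central_conic_def)
  next
    case 3
    have "((r$i)\<^sup>2 - C) * \<alpha> = ((r$j)\<^sup>2 - C) * \<beta>"
      using coeffs(4,5) by (rule trans[OF _ sym])
    then have C: "C = 0" using \<alpha>\<beta> 3 by simp
    then have "\<rho> = 0"
      using coeffs(4) 3 by simp
    moreover have rk: "r$k \<noteq> 0"
      using r 3 vec_eq_3_distinct[OF dist, of r 0] by auto
    ultimately have "u$k = 0"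
      using 3 by (simp add: \<rho>_def ip)
    then have "circular_cone u r \<theta> = {x. x$k = 0}"
      using C 3 rk by (auto simp: circular_cone_iff C_def ip)
    then show ?thesis by blast
  qed
qed

section \<open>The cone from a point of one focal conic to the other\<close>

text \<open>
  Here \<open>A\<close> and \<open>D\<close> stand for \<open>e\<^sub>m - e\<^sub>i\<close> and \<open>e\<^sub>m - e\<^sub>k\<close>, both positive because \<open>e\<^sub>m\<close> is the largest.
  As \<open>u\<^sub>i = 0\<close>, the quadratic form of the cone has the \<open>i\<close>-th coordinate vector as an eigenvector.
  Subtracting that eigenvalue times \<open>d \<bullet> d\<close> leaves a form in \<open>d\<^sub>m\<close> and \<open>d\<^sub>k\<close> which, by the
  equation of the first conic at \<open>u\<close>, is a multiple of the square \<open>(q \<bullet> d)\<^sup>2\<close> with \<open>q\<close> tangent to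
  that conic. This is the double eigenvalue that makes the cone circular. The same equation gives
  \<open>q \<bullet> q - C = A (A - D)\<^sup>2 > 0\<close>, so an aperture with \<open>(cos \<theta>)\<^sup>2 = C / (q \<bullet> q)\<close> exists.
\<close>
lemma focal_cone_circular:
  assumes dist: "distinct [m, i, k]" and A: "A > 0" and D: "D > 0" and AD: "A \<noteq> D"
    and u: "u \<in> central_conic m k i A (A - D)"
  obtains r \<theta> where "is_circular_cone u r \<theta> (cone_from u (central_conic m i k D (D - A)))"
    and "(cos \<theta>)\<^sup>2 < 1"
    and "symmetry_axis u r = tangent_line (central_conic m k i A (A - D)) u"
proof -
  have ui: "u$i = 0" and u1: "(u$m)\<^sup>2 / A + (u$k)\<^sup>2 / (A - D) = 1"
    using u by (simp_all add: central_conic_def)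
  have H: "(u$m)\<^sup>2 * (A - D) + (u$k)\<^sup>2 * A = A * (A - D)"
    using u1 A AD by (simp add: field_simps)
  obtain q :: "real^3" where q: "q$m = u$k * A" "q$i = 0" "q$k = - (u$m * (A - D))"
    using vec_3_exists[OF dist] by blast
  note ip = inner_3_distinct[OF dist]
  define C where "C = (u$k)\<^sup>2 * A * D"
  have qq: "q \<bullet> q = C + A * (A - D)\<^sup>2"
  proof -
    have "(A - D) * ((u$m)\<^sup>2 * (A - D) + (u$k)\<^sup>2 * A) = (A - D) * (A * (A - D))"
      unfolding H ..
    then show ?thesis
      by (simp add: ip q C_def power2_eq_square algebra_simps)
  qed
  have C: "0 \<le> C" "C < q \<bullet> q"
    using A D AD by (simp_all add: qq C_def)
  then have qpos: "q \<bullet> q > 0" by linarith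
  then have nq: "norm q \<noteq> 0" by auto
  define r where "r = q /\<^sub>R norm q"
  define c where "c = sqrt (C / (q \<bullet> q))"
  define \<theta> where "\<theta> = arccos c"
  have c2: "c\<^sup>2 = C / (q \<bullet> q)" and c0: "0 \<le> c" and c1: "c < 1"
    using C qpos by (simp_all add: c_def)
  have cos: "cos \<theta> = c" and \<theta>: "0 \<le> \<theta>" "\<theta> \<le> pi/2"
    using c0 c1 arccos_le_pi2[of c] by (simp_all add: \<theta>_def arccos_lbound del: arccos_le_pi2)
  have mem: "x \<in> circular_cone u r \<theta> \<longleftrightarrow> (q \<bullet> (x - u))\<^sup>2 = C * ((x - u) \<bullet> (x - u))" for x
    using qpos nq
    by (simp add: circular_cone_iff cos c2 r_def power_mult_distrib power_inverse power2_norm_eq_inner field_simps)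
  have "cone_from u (central_conic m i k D (D - A)) = circular_cone u r \<theta>"
  proof -
    have unot: "u \<notin> central_conic m i k D (D - A)"
      using u1 ui A D AD by (auto simp: central_conic_def)
    have foc: "u$k = 0 \<longrightarrow> u$i = 0 \<and> (u$m)\<^sup>2 = D - (D - A)"
      using u1 ui A by (auto simp: field_simps)
    have iff: "(u$m * d$k - u$k * d$m)\<^sup>2 / D + (u$i * d$k - u$k * d$i)\<^sup>2 / (D - A) = (d$k)\<^sup>2
        \<longleftrightarrow> (q \<bullet> d)\<^sup>2 = C * (d \<bullet> d)" (is "?L = _ \<longleftrightarrow> _") for d
    proof -
      have "D / (D - A) * (A - D) = - D" using AD by (simp add: field_simps)
      then have L: "A * D * (A - D) * (?L - (d$k)\<^sup>2) = A * (A - D) * (u$m * d$k - u$k * d$m)\<^sup>2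
          - A * D * (u$k * d$i)\<^sup>2 - A * D * (A - D) * (d$k)\<^sup>2"
        using D AD ui by (simp add: field_simps)
      have "(q \<bullet> d)\<^sup>2 - C * (d \<bullet> d) = A * D * (A - D) * (?L - (d$k)\<^sup>2)"
        unfolding L ip q C_def using H by algebra
      then show ?thesis using A D AD by auto
    qed
    have "D - A \<noteq> 0" using AD by simp
    show ?thesis
      unfolding cone_from_central_conic[OF dist D \<open>D - A \<noteq> 0\<close> unot central_conic_nonempty[OF dist D] foc]
      by (auto simp: mem iff Let_def)
  qed
  then have 1: "is_circular_cone u r \<theta> (cone_from u (central_conic m i k D (D - A)))"
    using \<theta> nq by (simp add: is_circular_cone_def r_def)
  have 2: "(cos \<theta>)\<^sup>2 < 1"
    using C qpos by (simp add: cos c2)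
  have tan: "tangent_vector (central_conic m k i A (A - D)) u v \<longleftrightarrow> (\<exists>t. v = t *\<^sub>R r)" for v
    unfolding tangent_vector_central_conic_iff[OF u]
  proof
    assume v: "v$i = 0 \<and> u$m * v$m / A + u$k * v$k / (A - D) = 0"
    then have perp: "u$m * v$m * (A - D) + u$k * v$k * A = 0"
      using A AD by (simp add: field_simps)
    have "(q \<bullet> q) * v$m = (q \<bullet> v) * q$m" "(q \<bullet> q) * v$k = (q \<bullet> v) * q$k"
      unfolding ip q using perp v by algebra+
    then have "v = ((q \<bullet> v) / (q \<bullet> q)) *\<^sub>R q"
      using qpos v by (simp add: vec_eq_3_distinct[OF dist] q(2) field_simps)
    moreover have "q = norm q *\<^sub>R r"
      using nq by (simp add: r_def)
    ultimately have "v = ((q \<bullet> v) / (q \<bullet> q) * norm q) *\<^sub>R r"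
      by (metis scaleR_scaleR)
    then show "\<exists>t. v = t *\<^sub>R r" by blast
  next
    assume "\<exists>t. v = t *\<^sub>R r"
    then show "v$i = 0 \<and> u$m * v$m / A + u$k * v$k / (A - D) = 0"
      using A AD by (auto simp: r_def q)
  qed
  have "symmetry_axis u r = tangent_line (central_conic m k i A (A - D)) u"
    unfolding symmetry_axis_def tangent_line_def tan by auto
  with 1 2 show thesis using that by blast
qed

theorem mainTheorem1:
  fixes a b c :: real
  assumes "a \<noteq> b" and "b \<noteq> c" and "a \<noteq> c"
  shows
    "(card {k. real_curve (space_curve a b c k)} = 2 \<and>
      card {k. imaginary_curve (space_curve a b c k)} = 1) \<and>
     (\<forall>i j u. i \<noteq> j \<and> real_curve (space_curve a b c i) \<and> real_curve (space_curve a b c j) \<and>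
        u \<in> space_curve a b c i \<longrightarrow>
          circular_from u (cone_from u (space_curve a b c j)) \<and>
          (\<forall>r \<theta>. is_circular_cone u r \<theta> (cone_from u (space_curve a b c j)) \<longrightarrow>
             symmetry_axis u r = tangent_line (space_curve a b c i) u)) \<and>
     (\<forall>u k. (\<forall>i. real_curve (space_curve a b c i) \<longrightarrow> u \<notin> space_curve a b c i) \<and>
        real_curve (space_curve a b c k) \<and>
        cone_from u (space_curve a b c k) \<noteq> {x. x $ k = 0} \<longrightarrow>
          \<not> circular_from u (cone_from u (space_curve a b c k)))"
proof -
  define e where "e = ($) (vector [a, b, c] :: real^3)"
  have e_inj: "e i \<noteq> e j" if "i \<noteq> j" for i j
    using assms that exhaust_3[of i] exhaust_3[of j] by (auto simp: e_def vector_3)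
  note curve = space_curve_central_conic[of _ _ _ a b c, folded e_def]
  note real_iff = real_space_curve_iff[of _ _ _ a b c, folded e_def]
  have "Max (range e) \<in> range e" by (rule Max_in) auto
  then obtain m where "e m = Max (range e)" by (metis rangeE)
  then have "e n \<le> e m" for n by simp
  then have m: "e n < e m" if "n \<noteq> m" for n
    using e_inj[OF that] by (simp add: order_less_le)
  have third: "\<exists>j. distinct [i, j, k]" if "i \<noteq> k" for i k :: 3
  proof -
    have "card {i, k} < CARD(3)" using that by simp
    then have "UNIV \<noteq> {i, k}" by force
    then show ?thesis using that by auto
  qed
  have real: "real_curve (space_curve a b c k) \<longleftrightarrow> k \<noteq> m" for k
  proof
    assume k: "real_curve (space_curve a b c k)"
    obtain n :: 3 where "n \<noteq> k" using exhaust_3[of k] by (metis zero_neq_one)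
    then obtain j where "distinct [n, j, k]" using third by blast
    with k show "k \<noteq> m"
      using real_iff[of n j k] \<open>e n \<le> e m\<close> \<open>e j \<le> e m\<close> by auto
  next
    assume k: "k \<noteq> m"
    then obtain j where "distinct [m, j, k]" using third by metis
    with k show "real_curve (space_curve a b c k)"
      using real_iff[of m j k] m by blast
  qed
  have "{k. real_curve (space_curve a b c k)} = UNIV - {m}"
    "{k. imaginary_curve (space_curve a b c k)} = {m}"
    using real by (auto simp: real_curve_def imaginary_curve_def)
  then have cards: "card {k. real_curve (space_curve a b c k)} = 2 \<and>
      card {k. imaginary_curve (space_curve a b c k)} = 1"
    by (simp add: card_Diff_singleton)
  have circ: "circular_from u (cone_from u (space_curve a b c k)) \<and>
      (\<forall>r \<theta>. is_circular_cone u r \<theta> (cone_from u (space_curve a b c k)) \<longrightarrow>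
         symmetry_axis u r = tangent_line (space_curve a b c i) u)"
    if ik: "i \<noteq> k" "i \<noteq> m" "k \<noteq> m" and u: "u \<in> space_curve a b c i" for i k u
  proof -
    have dist: "distinct [m, i, k]" "distinct [m, k, i]" using ik by auto
    have ci: "space_curve a b c i = central_conic m k i (e m - e i) ((e m - e i) - (e m - e k))"
      and ck: "space_curve a b c k = central_conic m i k (e m - e k) ((e m - e k) - (e m - e i))"
      using curve[OF dist(1)] curve[OF dist(2)] by simp_all
    have "e m - e i > 0" "e m - e k > 0" "e m - e i \<noteq> e m - e k"
      using m ik e_inj[OF ik(1)] by auto
    then obtain r \<theta> where r: "is_circular_cone u r \<theta> (cone_from u (space_curve a b c k))"
      and \<theta>: "(cos \<theta>)\<^sup>2 < 1" and axis: "symmetry_axis u r = tangent_line (space_curve a b c i) u"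
      using focal_cone_circular[OF dist(1), of "e m - e i" "e m - e k" u] u unfolding ci ck by blast
    have "symmetry_axis u r' = symmetry_axis u r"
      if "is_circular_cone u r' \<theta>' (cone_from u (space_curve a b c k))" for r' \<theta>'
    proof -
      have "r' = r \<or> r' = - r"
        using circular_cone_axis_unique[of u r \<theta> r' \<theta>'] r that \<theta> by (simp add: is_circular_cone_def)
      moreover have "symmetry_axis u (- r) = symmetry_axis u r"
        unfolding symmetry_axis_def by auto (metis add_uminus_conv_diff scaleR_minus_left minus_minus)+
      ultimately show ?thesis by auto
    qed
    then show ?thesis using r axis by (auto simp: circular_from_def)
  qed
  have not_circ: "\<not> circular_from u (cone_from u (space_curve a b c k))"
    if u: "\<And>i. u \<notin> space_curve a b c i" and k: "k \<noteq> m"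
      and plane: "cone_from u (space_curve a b c k) \<noteq> {x. x $ k = 0}" for u k
  proof
    assume "circular_from u (cone_from u (space_curve a b c k))"
    then obtain r \<theta> where r: "norm r = 1" and S: "cone_from u (space_curve a b c k) = circular_cone u r \<theta>"
      by (auto simp: circular_from_def is_circular_cone_def)
    obtain j where dist: "distinct [m, j, k]" using third k by metis
    then have dist': "distinct [m, k, j]" "distinct [j, k, m]" by auto
    have "space_curve a b c k \<subseteq> circular_cone u r \<theta>"
      using cone_from_direction[OF _ u[of k], of _ 1] by (auto simp flip: S)
    then have "u \<in> central_conic m k j (e m - e k - (e j - e k)) (- (e j - e k)) \<or>
        u \<in> central_conic j k m (e j - e k - (e m - e k)) (- (e m - e k))"
      using circular_cone_through_conic[OF dist, of "e m - e k" "e j - e k" r u \<theta>] r plane S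
        m[OF k] e_inj[of j k] e_inj[of m j] dist
      by (auto simp: curve[OF dist])
    then show False
      using u[of j] u[of m] by (simp add: curve[OF dist'(1)] curve[OF dist'(2)])
  qed
  have "u \<notin> space_curve a b c i"
    if "\<forall>i. real_curve (space_curve a b c i) \<longrightarrow> u \<notin> space_curve a b c i" for u i
    using that by (auto simp: real_curve_def)
  then show ?thesis
    using cards circ not_circ unfolding real by metis
qed

end
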